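(* Let $P=F\oplus L$ be a poset on $[n]$, where $F$ is a rooted forest and $L$ is a ladder. Let $p_x=\min\{x_i:1\le i\le n\}$. Then for every integer $k\ge(n-1)/p_x$, the distance to stationarity of the promotion Markov chain on $\mathcal L(P)$ satisfies $$\|D^k-\omega\|_{TV}\le\exp\left(-\frac{(kp_x-(n-1))^2}{2kp_x}\right),$$ where $D^k$ is the distribution of the chain after $k$ steps and $\omega$ is its stationary distribution.
   Context: The ordinal sum $P\oplus Q$ is the disjoint union with the relations of $P$, of $Q$, and $x\prec y$ for all $x\in P$, $y\in Q$. A rooted tree is a connected poset in which each element is covered by at most one element; a rooted forest is a disjoint union of rooted trees. A ladder is an ordinal sum $Q_1\oplus\cdots\oplus Q_m$ of antichains of size 1 or 2. $F$ or $L$ may be empty. A linear extension of $P$ is a word $\pi=\pi_1\cdots\pi_n$ listing each element of $P$ once such that $\pi_i\prec\pi_j$ implies $i<j$; $\mathcal L(P)$ is the set of them. For $1\le i\le n-1$, $\tau_i\pi$ is obtained from $\pi$ by interchanging $\pi_i$ and $\pi_{i+1}$ if these are incomparable in $P$, and $\tau_i\pi=\pi$ otherwise. For $1\le i\le n$, $\partial_i=\tau_{n-1}\cdots\tau_{i+1}\tau_i$ ($\tau_i$ applied first; $\partial_n$ is the identity). Let $x_1,\dots,x_n>0$ with $\sum_ix_i=1$. The promotion Markov chain has state space $\mathcal L(P)$ and, from $\pi$, moves to $\partial_i\pi$ with probability $x_{\pi_i}$, $i=1,\dots,n$. It is irreducible and aperiodic, hence has a unique stationary distribution $\omega$. The chain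 is started from an arbitrary state, and the total variation distance is $\|D^k-\omega\|_{TV}=\frac12\sum_{\pi\in\mathcal L(P)}|D^k(\pi)-\omega(\pi)|$. *)

theory Defs
  imports "HOL-Probability.Probability"
begin

text \<open>
  A poset is encoded by its reflexive order relation \<open>r\<close> (a \<^const>\<open>Partial_order\<close>), where
  \<open>(a, b) \<in> r\<close> means \<open>a \<preceq> b\<close>; its ground set is \<open>Field r\<close>. The empty poset is \<open>{}\<close>.
\<close>

definition strictly_below :: "'a rel \<Rightarrow> 'a \<Rightarrow> 'a \<Rightarrow> bool" where
  "strictly_below r a b \<longleftrightarrow> (a, b) \<in> r \<and> a \<noteq> b"

definition incomparable :: "'a rel \<Rightarrow> 'a \<Rightarrow> 'a \<Rightarrow> bool" where
  "incomparable r a b \<longleftrightarrow> (a, b) \<notin> r \<and> (b, a) \<notin> r"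

definition covered_by :: "'a rel \<Rightarrow> 'a \<Rightarrow> 'a \<Rightarrow> bool" where
  "covered_by r a b \<longleftrightarrow>
     strictly_below r a b \<and> (\<nexists>c. strictly_below r a c \<and> strictly_below r c b)"

text \<open>Only meaningful when the two ground sets are disjoint; this is required wherever it is used.\<close>

definition ordinal_sum :: "'a rel \<Rightarrow> 'a rel \<Rightarrow> 'a rel" where
  "ordinal_sum r s = r \<union> s \<union> Field r \<times> Field s"

definition connected_poset :: "'a rel \<Rightarrow> bool" where
  "connected_poset r \<longleftrightarrow> (\<forall>a\<in>Field r. \<forall>b\<in>Field r. (a, b) \<in> (r \<union> r\<inverse>)\<^sup>*)"

definition rooted_tree :: "'a rel \<Rightarrow> bool" where
  "rooted_tree r \<longleftrightarrow>
     Partial_order r \<and> connected_poset r \<and> (\<forall>a\<in>Field r. \<exists>\<^sub>\<le>\<^sub>1 b. covered_by r a b)"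

definition rooted_forest :: "'a rel \<Rightarrow> bool" where
  "rooted_forest r \<longleftrightarrow>
     (\<exists>T. (\<forall>t\<in>T. rooted_tree t) \<and> pairwise (\<lambda>s t. disjnt (Field s) (Field t)) T \<and> r = \<Union>T)"

text \<open>\<open>Id_on A\<close> is the antichain with ground set \<open>A\<close>.\<close>

inductive ladder :: "'a rel \<Rightarrow> bool" where
  ladder_empty: "ladder {}"
| ladder_step: "card A \<in> {1, 2} \<Longrightarrow> ladder r \<Longrightarrow> A \<inter> Field r = {} \<Longrightarrow> ladder (ordinal_sum (Id_on A) r)"

text \<open>
  A word \<open>\<pi>\<^sub>1 \<dots> \<pi>\<^sub>n\<close> is a list \<open>\<pi>\<close> of length \<open>n\<close>. Positions are counted from 1 in
  \<open>swap_step\<close>, \<open>promotion\<close> and \<open>position_pmf\<close>, so \<open>\<pi>\<^sub>i\<close> is \<open>\<pi> ! (i - 1)\<close> there.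
\<close>

definition linear_extensions :: "'a rel \<Rightarrow> 'a list set" where
  "linear_extensions r =
     {\<pi>. distinct \<pi> \<and> set \<pi> = Field r \<and>
         (\<forall>i<length \<pi>. \<forall>j<length \<pi>. strictly_below r (\<pi> ! i) (\<pi> ! j) \<longrightarrow> i < j)}"

definition swap_step :: "'a rel \<Rightarrow> nat \<Rightarrow> 'a list \<Rightarrow> 'a list" where
  "swap_step r i \<pi> =
     (if incomparable r (\<pi> ! (i - 1)) (\<pi> ! i)
      then \<pi>[i - 1 := \<pi> ! i, i := \<pi> ! (i - 1)] else \<pi>)"

text \<open>\<open>fold\<close> applies the operators for \<open>i, i + 1, \<dots>, n - 1\<close> in this order.\<close>

definition promotion :: "'a rel \<Rightarrow> nat \<Rightarrow> 'a list \<Rightarrow> 'a list" where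
  "promotion r i \<pi> = fold (swap_step r) [i..<length \<pi>] \<pi>"

definition position_pmf :: "('a \<Rightarrow> real) \<Rightarrow> 'a list \<Rightarrow> nat pmf" where
  "position_pmf x \<pi> = embed_pmf (\<lambda>i. if i \<in> {1..length \<pi>} then x (\<pi> ! (i - 1)) else 0)"

text \<open>
  The argument of \<^const>\<open>embed_pmf\<close> is a probability mass function whenever \<open>x\<close> is a
  nonnegative weighting of total mass 1 on the letters of the duplicate-free word \<open>\<pi>\<close>.
\<close>

lemma pmf_position_pmf:
  assumes "distinct \<pi>" and "\<And>a. a \<in> set \<pi> \<Longrightarrow> 0 \<le> x a" and "(\<Sum>a\<in>set \<pi>. x a) = 1"
  shows "pmf (position_pmf x \<pi>) i = (if i \<in> {1..length \<pi>} then x (\<pi> ! (i - 1)) else 0)"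
proof -
  let ?f = "\<lambda>i. if i \<in> {1..length \<pi>} then x (\<pi> ! (i - 1)) else 0"
  have nonneg: "0 \<le> ?f i" for i
    using assms(2) by auto
  have "bij_betw (\<lambda>i. \<pi> ! i) {..<length \<pi>} (set \<pi>)"
    using assms(1) by (intro bij_betw_nth) auto
  then have "(\<Sum>i<length \<pi>. x (\<pi> ! i)) = 1"
    using assms(3) sum.reindex_bij_betw[of "\<lambda>i. \<pi> ! i" "{..<length \<pi>}" "set \<pi>" x] by simp
  moreover have "(\<Sum>i\<in>{1..length \<pi>}. ?f i) = (\<Sum>i<length \<pi>. x (\<pi> ! i))"
    by (rule sum.reindex_bij_witness[where i = Suc and j = "\<lambda>i. i - 1"]) auto
  ultimately have sum1: "(\<Sum>i\<in>{1..length \<pi>}. ?f i) = 1"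
    by simp
  have "(\<integral>\<^sup>+i. ennreal (?f i) \<partial>count_space UNIV) = (\<Sum>i\<in>{1..length \<pi>}. ennreal (?f i))"
    by (rule nn_integral_count_space') auto
  also have "\<dots> = ennreal (\<Sum>i\<in>{1..length \<pi>}. ?f i)"
    by (intro sum_ennreal nonneg)
  finally have "(\<integral>\<^sup>+i. ennreal (?f i) \<partial>count_space UNIV) = 1"
    using sum1 by simp
  then show ?thesis
    unfolding position_pmf_def by (intro pmf_embed_pmf nonneg)
qed

definition promotion_kernel :: "'a rel \<Rightarrow> ('a \<Rightarrow> real) \<Rightarrow> 'a list \<Rightarrow> 'a list pmf" where
  "promotion_kernel r x \<pi> = map_pmf (\<lambda>i. promotion r i \<pi>) (position_pmf x \<pi>)"

definition chain_distribution ::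
    "('s \<Rightarrow> 's pmf) \<Rightarrow> 's \<Rightarrow> nat \<Rightarrow> 's pmf" where
  "chain_distribution K s k = ((\<lambda>D. bind_pmf D K) ^^ k) (return_pmf s)"

definition stationary_distribution :: "'s set \<Rightarrow> ('s \<Rightarrow> 's pmf) \<Rightarrow> 's pmf \<Rightarrow> bool" where
  "stationary_distribution S K \<omega> \<longleftrightarrow> set_pmf \<omega> \<subseteq> S \<and> bind_pmf \<omega> K = \<omega>"

definition tv_distance :: "'s set \<Rightarrow> 's pmf \<Rightarrow> 's pmf \<Rightarrow> real" where
  "tv_distance S D \<omega> = 1 / 2 * (\<Sum>s\<in>S. \<bar>pmf D s - pmf \<omega> s\<bar>)"

end

theory Submission
  imports Defs
begin

text \<open>
  Index the moves by letters instead of positions: with probability \<open>x\<^sub>a\<close> the letter \<open>a\<close> is promoted.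
  Run two copies of the chain with the same letters. For suitable upper sets \<open>D\<close> of \<open>P\<close>, the
  subword on \<open>D\<close> of the new word depends only on the letter and on the subword on \<open>D\<close> of the old one,
  so copies that agree on \<open>D\<close> go on agreeing there. Moreover, as long as \<open>D\<close> is not the whole poset,
  promoting a maximal element \<open>a\<close> of the complement makes the copies agree on a larger such set:
  \<open>D \<union> {a}\<close> in the forest, \<open>D\<close> together with the whole rung of \<open>a\<close> in the ladder. Hence \<open>n\<close>
  successes, each of conditional probability at least \<open>p\<^sub>x\<close>, force the copies to coincide.
  For \<open>0 < z \<le> 1\<close> the exponential moment of the number of successes bounds the distance by
  \<open>z\<^bsup>1-n\<^esup> (1 - p\<^sub>x + p\<^sub>x z)\<^bsup>k\<^esup>\<close>, and \<open>z = (n - 1) / (k p\<^sub>x)\<close> gives the claim.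
\<close>

section \<open>Promotion of a letter\<close>

text \<open>
  The swap steps carry a letter \<open>h\<close> to the right through the rest of the word; a letter
  comparable to \<open>h\<close> stops it and is carried on instead.
\<close>

fun slide :: "'a rel \<Rightarrow> 'a \<Rightarrow> 'a list \<Rightarrow> 'a list" where
  "slide r h [] = [h]"
| "slide r h (y # ys) = (if incomparable r h y then y # slide r h ys else h # slide r y ys)"

definition promote_letter :: "'a rel \<Rightarrow> 'a \<Rightarrow> 'a list \<Rightarrow> 'a list" where
  "promote_letter r a w = takeWhile (\<lambda>b. b \<noteq> a) w @ slide r a (tl (dropWhile (\<lambda>b. b \<noteq> a) w))"

lemma promote_letter_append:
  assumes "a \<notin> set u"
  shows "promote_letter r a (u @ a # v) = u @ slide r a v"
proof -
  have "takeWhile (\<lambda>b. b \<noteq> a) (u @ a # v) = u"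
    using assms by (subst takeWhile_append2) auto
  moreover have "dropWhile (\<lambda>b. b \<noteq> a) (u @ a # v) = a # v"
    using assms by (subst dropWhile_append2) auto
  ultimately show ?thesis
    by (simp add: promote_letter_def)
qed

text \<open>The prefix \<open>u\<close> is generalised so that its length records the position
  reached: each swap step hands one more letter over to \<open>u\<close>, and \<open>h\<close> is
  the letter currently carried.\<close>

lemma fold_swap_step:
  "fold (swap_step r) [Suc (length u)..<Suc (length u + length v)] (u @ h # v) = u @ slide r h v"
proof (induction v arbitrary: u h)
  case (Cons y ys)
  have upt: "[Suc (length u)..<Suc (length u + length (y # ys))] =
      Suc (length u) # [Suc (Suc (length u))..<Suc (Suc (length u) + length ys)]"
    by (subst upt_conv_Cons) auto
  show ?case
  proof (cases "incomparable r h y")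
    case True
    then have "swap_step r (Suc (length u)) (u @ h # y # ys) = (u @ [y]) @ h # ys"
      by (simp add: swap_step_def nth_append list_update_append)
    then show ?thesis
      using Cons.IH[of "u @ [y]" h] True unfolding upt by simp
  next
    case False
    then have "swap_step r (Suc (length u)) (u @ h # y # ys) = (u @ [h]) @ y # ys"
      by (simp add: swap_step_def nth_append)
    then show ?thesis
      using Cons.IH[of "u @ [h]" y] False unfolding upt by simp
  qed
qed simp

text \<open>Positions in \<open>promotion\<close> count from 1, so \<open>Suc i\<close> addresses
  \<open>w ! i\<close>. Distinctness makes this the first occurrence of the letter, where
  \<open>promote_letter\<close> splits the word.\<close>

lemma promotion_eq_promote_letter:
  assumes "distinct w" "i < length w"
  shows "promotion r (Suc i) w = promote_letter r (w ! i) w"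
proof -
  define u v where "u = take i w" and "v = drop (Suc i) w"
  have w: "w = u @ w ! i # v"
    using assms(2) by (simp add: u_def v_def id_take_nth_drop)
  have len: "length u = i" "length w = Suc (length u + length v)"
    using assms(2) by (auto simp: u_def v_def)
  have "w ! i \<notin> set u"
    using assms(1) w by (metis disjoint_insert(1) distinct_append list.set(2))
  then show ?thesis
    using fold_swap_step[of r u v "w ! i"] promote_letter_append[of "w ! i" u r v] w len
    unfolding promotion_def by metis
qed

lemma mset_slide: "mset (slide r h v) = mset (h # v)"
  by (induction v arbitrary: h) auto

lemma set_slide [simp]: "set (slide r h v) = insert h (set v)"
  using mset_slide[of r h v] by (metis list.set(2) set_mset_mset)

lemma distinct_slide [simp]: "distinct (slide r h v) \<longleftrightarrow> distinct (h # v)"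
  using mset_slide[of r h v] by (metis mset_eq_imp_distinct_iff)

abbreviation word_sorted :: "'a rel \<Rightarrow> 'a list \<Rightarrow> bool" where
  "word_sorted r \<equiv> sorted_wrt (\<lambda>a b. \<not> strictly_below r b a)"

text \<open>Only incomparable letters pass each other, so no strict relation is ever
  reversed.\<close>

lemma word_sorted_slide: "word_sorted r (h # v) \<Longrightarrow> word_sorted r (slide r h v)"
  by (induction v arbitrary: h) (auto simp: incomparable_def strictly_below_def)

text \<open>The contrapositive of the index condition is a \<open>sorted_wrt\<close> condition,
  which splits along appends and suits list induction.\<close>

lemma linear_extensions_iff:
  "w \<in> linear_extensions r \<longleftrightarrow> distinct w \<and> set w = Field r \<and> word_sorted r w"
proof -
  have "(\<forall>i<length w. \<forall>j<length w. strictly_below r (w ! i) (w ! j) \<longrightarrow> i < j) \<longleftrightarrow> word_sorted r w"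
    unfolding sorted_wrt_iff_nth_less
    by (metis linorder_neqE_nat order_less_trans order_less_irrefl strictly_below_def)
  then show ?thesis
    by (auto simp: linear_extensions_def)
qed

lemma promote_letter_linear_extension:
  assumes "w \<in> linear_extensions r" "a \<in> Field r"
  shows "promote_letter r a w \<in> linear_extensions r"
proof -
  have "a \<in> set w"
    using assms by (simp add: linear_extensions_iff)
  then obtain u v where w: "w = u @ a # v" and u: "a \<notin> set u"
    by (meson split_list_first)
  have "word_sorted r (slide r a v)"
    using assms(1) unfolding w linear_extensions_iff
    by (intro word_sorted_slide) (auto simp: sorted_wrt_append)
  then show ?thesis
    using assms(1) unfolding w promote_letter_append[OF u] linear_extensions_iff
    by (auto simp: sorted_wrt_append)
qed

section \<open>Subwords on upper sets\<close>

definition upper_set :: "'a rel \<Rightarrow> 'a set \<Rightarrow> bool" where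
  "upper_set r D \<longleftrightarrow> (\<forall>a\<in>D. \<forall>b. strictly_below r a b \<longrightarrow> b \<in> D)"

text \<open>What is seen on \<open>D\<close> of the promotion of a letter \<open>b \<notin> D\<close>.\<close>

fun enter :: "'a rel \<Rightarrow> 'a \<Rightarrow> 'a list \<Rightarrow> 'a list" where
  "enter r b [] = []"
| "enter r b (y # ys) = (if strictly_below r b y then slide r y ys else y # enter r b ys)"

text \<open>In a sorted word a letter that stops the carried letter lies above it, hence again in
  \<open>D\<close>. Letters outside \<open>D\<close> are merely passed and leave no trace on the
  subword.\<close>

lemma filter_slide_in:
  assumes "upper_set r D" "h \<in> D" "word_sorted r (h # v)"
  shows "filter (\<lambda>a. a \<in> D) (slide r h v) = slide r h (filter (\<lambda>a. a \<in> D) v)"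
  using assms(2,3)
proof (induction v arbitrary: h)
  case (Cons y ys)
  have "incomparable r h y" if "y \<notin> D"
    using that Cons.prems assms(1) unfolding incomparable_def upper_set_def strictly_below_def
    by auto
  then show ?case
    using Cons by auto
qed simp

text \<open>The carried letter \<open>h\<close> may change while outside \<open>D\<close>, but it
  stays equal to \<open>b\<close> or above \<open>b\<close>. By transitivity and
  \<open>module\<close>, \<open>h\<close> is stopped at a letter of \<open>D\<close> exactly when
  \<open>b\<close> would be, so the subword on \<open>D\<close> cannot tell them apart. After the
  first such stop the carried letter lies in \<open>D\<close>.\<close>

lemma filter_slide_notin:
  assumes "upper_set r D" "trans r" "antisym r"
    and module: "\<And>h y. strictly_below r b h \<Longrightarrow> strictly_below r b y \<Longrightarrow> h \<notin> D \<Longrightarrow> y \<in> D \<Longrightarrow>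
      strictly_below r h y"
    and "h \<notin> D" "b = h \<or> strictly_below r b h" "word_sorted r (h # v)" "distinct (h # v)"
  shows "filter (\<lambda>a. a \<in> D) (slide r h v) = enter r b (filter (\<lambda>a. a \<in> D) v)"
  using assms(5-)
proof (induction v arbitrary: h)
  case (Cons y ys)
  have trans: "strictly_below r b y" if "strictly_below r h y"
    using that Cons.prems(2) assms(2,3) unfolding strictly_below_def
    by (metis antisymD transD)
  \<comment> \<open>Sortedness excludes \<open>y\<close> below \<open>h\<close>, and distinctness
    excludes equality.\<close>
  have comp: "incomparable r h y \<longleftrightarrow> \<not> strictly_below r h y"
    using Cons.prems by (auto simp: incomparable_def strictly_below_def)
  show ?case
  proof (cases "y \<in> D")
    case True
    have "strictly_below r b y \<longleftrightarrow> strictly_below r h y"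
      using trans module Cons.prems(1,2) True by blast
    then show ?thesis
      using Cons True comp filter_slide_in[OF assms(1), of y ys] by auto
  next
    case False
    then show ?thesis
      using Cons trans comp by auto
  qed
qed simp

lemma enter_append:
  "(\<And>z. z \<in> set u \<Longrightarrow> \<not> strictly_below r b z) \<Longrightarrow> enter r b (u @ v) = u @ enter r b v"
  by (induction u) auto

lemma slide_append:
  "(\<And>z. z \<in> set u \<Longrightarrow> incomparable r h z) \<Longrightarrow> slide r h (u @ v) = u @ slide r h v"
  by (induction u) auto

lemma split_linear_extension:
  assumes "w \<in> linear_extensions r" "a \<in> Field r"
  obtains u v where "w = u @ a # v" "a \<notin> set u" "a \<notin> set v" "word_sorted r (a # v)"
    "distinct (a # v)" "\<And>z. z \<in> set u \<Longrightarrow> \<not> strictly_below r a z"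
proof -
  have "a \<in> set w"
    using assms by (simp add: linear_extensions_iff)
  then obtain u v where w: "w = u @ a # v" and u: "a \<notin> set u"
    by (meson split_list_first)
  show thesis
    using assms(1) by (intro that[OF w u]) (auto simp: w linear_extensions_iff sorted_wrt_append)
qed

text \<open>The right-hand side sees \<open>w\<close> only through its subword on \<open>D\<close>;
  this is what lets copies that agree on \<open>D\<close> keep agreeing there.\<close>

lemma filter_promote_letter:
  assumes "upper_set r D" "trans r" "antisym r"
    and "\<And>h y. strictly_below r b h \<Longrightarrow> strictly_below r b y \<Longrightarrow> h \<notin> D \<Longrightarrow> y \<in> D \<Longrightarrow>
      strictly_below r h y"
    and "w \<in> linear_extensions r" "b \<in> Field r"
  shows "filter (\<lambda>a. a \<in> D) (promote_letter r b w) =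
    (if b \<in> D then promote_letter r b (filter (\<lambda>a. a \<in> D) w) else enter r b (filter (\<lambda>a. a \<in> D) w))"
proof -
  obtain u v where w: "w = u @ b # v" "b \<notin> set u" "b \<notin> set v" "word_sorted r (b # v)"
    "distinct (b # v)" "\<And>z. z \<in> set u \<Longrightarrow> \<not> strictly_below r b z"
    using split_linear_extension[OF assms(5,6)] by blast
  show ?thesis
  proof (cases "b \<in> D")
    case True
    then show ?thesis
      using w filter_slide_in[OF assms(1) True w(4)]
        promote_letter_append[of b "filter (\<lambda>a. a \<in> D) u" r "filter (\<lambda>a. a \<in> D) v"]
      by (simp add: promote_letter_append)
  next
    case False
    then have "filter (\<lambda>a. a \<in> D) (slide r b v) = enter r b (filter (\<lambda>a. a \<in> D) v)"
      using assms(1-4) w(4,5) by (intro filter_slide_notin) auto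
    moreover have "enter r b (filter (\<lambda>a. a \<in> D) u @ filter (\<lambda>a. a \<in> D) v) =
        filter (\<lambda>a. a \<in> D) u @ enter r b (filter (\<lambda>a. a \<in> D) v)"
      using w(6) by (intro enter_append) auto
    ultimately show ?thesis
      using False w(1,2) by (simp add: promote_letter_append)
  qed
qed

text \<open>Letters of \<open>D\<close> in front of \<open>a\<close> are incomparable to it: none is
  below, as \<open>D\<close> is an upper set without \<open>a\<close>, and none is above, by
  sortedness. Hence \<open>a\<close> might as well start at the front of the subword, and its actual
  position is forgotten.\<close>

lemma filter_promote_insert:
  assumes "upper_set r D" "upper_set r (insert a D)" "a \<notin> D"
    and "w \<in> linear_extensions r" "a \<in> Field r"
  shows "filter (\<lambda>b. b \<in> insert a D) (promote_letter r a w) = slide r a (filter (\<lambda>b. b \<in> D) w)"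
proof -
  obtain u v where w: "w = u @ a # v" "a \<notin> set u" "a \<notin> set v" "word_sorted r (a # v)"
    "distinct (a # v)" "\<And>z. z \<in> set u \<Longrightarrow> \<not> strictly_below r a z"
    using split_linear_extension[OF assms(4,5)] by blast
  have "filter (\<lambda>b. b \<in> insert a D) u = filter (\<lambda>b. b \<in> D) u"
    "filter (\<lambda>b. b \<in> insert a D) v = filter (\<lambda>b. b \<in> D) v"
    using w(2,3) by (auto intro: filter_cong)
  moreover have "incomparable r a z" if "z \<in> set (filter (\<lambda>b. b \<in> D) u)" for z
    using that w(2,6) assms(1,3) unfolding incomparable_def upper_set_def strictly_below_def
    by auto
  then have "slide r a (filter (\<lambda>b. b \<in> D) u @ filter (\<lambda>b. b \<in> D) v) =
      filter (\<lambda>b. b \<in> D) u @ slide r a (filter (\<lambda>b. b \<in> D) v)"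
    by (rule slide_append)
  ultimately show ?thesis
    using assms(3) filter_slide_in[OF assms(2) insertI1 w(4)] unfolding w(1)
    by (simp only: promote_letter_append[OF w(2)] filter_append filter.simps if_False)
qed

text \<open>Once a letter of \<open>D\<close> has occurred, sortedness admits no further letter of
  \<open>N\<close>.\<close>

lemma filter_Un_below:
  assumes "word_sorted r w" "\<And>a y. a \<in> N \<Longrightarrow> y \<in> D \<Longrightarrow> strictly_below r a y" "N \<inter> D = {}"
  shows "filter (\<lambda>b. b \<in> N \<union> D) w = filter (\<lambda>b. b \<in> N) w @ filter (\<lambda>b. b \<in> D) w"
  using assms(1)
proof (induction w)
  case (Cons y ys)
  have "filter (\<lambda>b. b \<in> N) ys = []" if "y \<in> D"
    using Cons.prems assms(2) that by (fastforce simp: filter_empty_conv)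
  then show ?case
    using Cons assms(3) by auto
qed simp

lemma distinct_set_singleton: "distinct xs \<Longrightarrow> set xs \<subseteq> {c} \<Longrightarrow> xs = [] \<or> xs = [c]"
  by (cases xs; cases "tl xs") auto

text \<open>The rung \<open>N\<close> holds \<open>a\<close> and at most one partner
  \<open>c\<close>. Either \<open>c\<close> already precedes \<open>a\<close> or \<open>a\<close>
  slides past it, so \<open>c\<close> ends up in front in both cases, and the old order of the rung
  is forgotten.\<close>

lemma filter_promote_rung:
  assumes "upper_set r (N \<union> D)" "a \<in> N" "N \<inter> D = {}" "N \<subseteq> Field r"
    and "\<And>b y. b \<in> N \<Longrightarrow> y \<in> D \<Longrightarrow> strictly_below r b y"
    and "\<And>b. b \<in> N - {a} \<Longrightarrow> incomparable r a b" "N - {a} \<subseteq> {c}"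
    and "w \<in> linear_extensions r"
  shows "filter (\<lambda>b. b \<in> N \<union> D) (promote_letter r a w) =
    (if c \<in> N - {a} then [c] else []) @ slide r a (filter (\<lambda>b. b \<in> D) w)"
proof -
  have a: "a \<in> Field r"
    using assms by auto
  obtain u v where w: "w = u @ a # v" "a \<notin> set u" "a \<notin> set v" "word_sorted r (a # v)"
    "distinct (a # v)" "\<And>z. z \<in> set u \<Longrightarrow> \<not> strictly_below r a z"
    using split_linear_extension[OF assms(8) a] by blast
  let ?N = "filter (\<lambda>b. b \<in> N)" and ?D = "filter (\<lambda>b. b \<in> D)"
  have lw: "distinct w" "set w = Field r" "word_sorted r w"
    using assms(8) by (auto simp: linear_extensions_iff)
  have uv: "word_sorted r u" "word_sorted r v"
    using lw(3) w(1) by (auto simp: sorted_wrt_append)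
  have Du: "?D u = []"
    using w(6) assms(2,5) by (auto simp: filter_empty_conv)
  have split: "filter (\<lambda>b. b \<in> N \<union> D) u = ?N u" "filter (\<lambda>b. b \<in> N \<union> D) v = ?N v @ ?D v"
    using filter_Un_below[OF uv(1) assms(5,3)] filter_Un_below[OF uv(2) assms(5,3)] Du by auto
  have dist: "distinct (?N u @ ?N v)"
    using lw(1) unfolding w(1) by auto
  have "insert a (set u \<union> set v) = Field r"
    using lw(2) unfolding w(1) by auto
  then have set: "set (?N u @ ?N v) = N - {a}"
    using w(2,3) assms(4) by auto
  have "?N u @ ?N v = [] \<or> ?N u @ ?N v = [c]"
    using dist assms(7) set by (intro distinct_set_singleton) simp_all
  \<comment> \<open>Only the concatenation is determined, since \<open>c\<close> may occur on either
    side of \<open>a\<close>.\<close>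
  then have Nuv: "?N u @ ?N v = (if c \<in> N - {a} then [c] else [])"
  proof
    assume *: "?N u @ ?N v = []"
    show ?thesis
      using set unfolding * by auto
  next
    assume *: "?N u @ ?N v = [c]"
    show ?thesis
      using set unfolding * by auto
  qed
  have slide_N: "slide r a (?N v @ ?D v) = ?N v @ slide r a (?D v)"
    using assms(6) w(3) by (intro slide_append) auto
  have "filter (\<lambda>b. b \<in> N \<union> D) u @ slide r a (filter (\<lambda>b. b \<in> N \<union> D) v) =
      (if c \<in> N - {a} then [c] else []) @ slide r a (?D v)"
    unfolding split slide_N Nuv[symmetric] by (rule append_assoc[symmetric])
  moreover have "filter (\<lambda>b. b \<in> N \<union> D) (slide r a v) = slide r a (filter (\<lambda>b. b \<in> N \<union> D) v)"
    using assms(2) by (intro filter_slide_in[OF assms(1) _ w(4)]) auto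
  moreover have "?D w = ?D v"
    using Du assms(2,3) w(1) by auto
  ultimately show ?thesis
    unfolding w(1) promote_letter_append[OF w(2)] by (simp only: filter_append)
qed

section \<open>Coalescence for a forest below a ladder\<close>

text \<open>Order-theoretic form of the structure: by \<open>forest\<close>, the elements of
  \<open>A\<close> above a given one form a chain; by \<open>weak\<close>, \<open>B\<close> is a
  weak order, whose incomparability classes are the rungs; by \<open>width\<close>, a rung has at
  most two elements.\<close>

locale forest_ladder =
  fixes r :: "'a rel" and A B :: "'a set"
  assumes order: "Partial_order r" and finite_Field: "finite (Field r)"
    and Field: "Field r = A \<union> B" and disjoint: "A \<inter> B = {}"
    and below: "\<And>a b. a \<in> A \<Longrightarrow> b \<in> B \<Longrightarrow> strictly_below r a b"
    and forest: "\<And>b h y. b \<in> A \<Longrightarrow> h \<in> A \<Longrightarrow> y \<in> A \<Longrightarrow> strictly_below r b h \<Longrightarrow> strictly_below r b y \<Longrightarrow>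
      h = y \<or> strictly_below r h y \<or> strictly_below r y h"
    and weak: "\<And>a c y. a \<in> B \<Longrightarrow> c \<in> B \<Longrightarrow> y \<in> B \<Longrightarrow> strictly_below r c y \<Longrightarrow>
      strictly_below r c a \<or> strictly_below r a y"
    and width: "\<And>a c d. a \<in> B \<Longrightarrow> c \<in> B \<Longrightarrow> d \<in> B \<Longrightarrow> incomparable r a c \<Longrightarrow> incomparable r a d \<Longrightarrow> c = d"
begin

lemma trans_r: "trans r" and antisym_r: "antisym r"
  using order by (auto simp: partial_order_on_def preorder_on_def)

lemma below_trans: "strictly_below r a b \<Longrightarrow> strictly_below r b c \<Longrightarrow> strictly_below r a c"
  using transD[OF trans_r, of a b c] antisymD[OF antisym_r, of a b]
  by (auto simp: strictly_below_def)

lemma below_irrefl: "\<not> strictly_below r a a"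
  by (simp add: strictly_below_def)

lemma below_Field: "strictly_below r a b \<Longrightarrow> a \<in> Field r \<and> b \<in> Field r"
  by (auto simp: strictly_below_def Field_def)

lemma below_notin_B:
  assumes "strictly_below r b y" "y \<in> A"
  shows "b \<notin> B"
proof
  assume "b \<in> B"
  then have "strictly_below r b b"
    by (intro below_trans[OF assms(1)] below[OF assms(2)])
  then show False
    by (simp add: below_irrefl)
qed

lemma maximal_exists:
  assumes "M \<subseteq> Field r" "M \<noteq> {}"
  obtains a where "a \<in> M" "\<And>b. b \<in> M \<Longrightarrow> \<not> strictly_below r a b"
proof -
  have "finite M"
    using assms(1) finite_Field by (rule finite_subset)
  then have "\<exists>a\<in>M. \<forall>b\<in>M. b \<noteq> a \<longrightarrow> \<not> strictly_below r a b"
  proof (rule Finite_Set.bex_max_element)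
    show "asymp_on M (strictly_below r)"
    proof (rule asymp_onI)
      show "\<not> strictly_below r b a" if "strictly_below r a b" for a b
        using below_trans[OF that, of a] below_irrefl[of a] by blast
    qed
    show "transp_on M (strictly_below r)"
      by (intro transp_onI) (rule below_trans)
  qed (rule assms(2))
  then obtain a where a: "a \<in> M" "\<forall>b\<in>M. b \<noteq> a \<longrightarrow> \<not> strictly_below r a b"
    by blast
  show thesis
  proof (rule that[OF a(1)])
    show "\<not> strictly_below r a b" if "b \<in> M" for b
    proof (cases "b = a")
      case True
      then show ?thesis
        by (simp add: below_irrefl)
    next
      case False
      then show ?thesis
        by (rule a(2)[rule_format, OF that])
    qed
  qed
qed

text \<open>The last condition says that \<open>D\<close> contains only whole rungs of the ladder \<open>B\<close>.\<close>

definition stage :: "'a set \<Rightarrow> bool" where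
  "stage D \<longleftrightarrow> D \<subseteq> Field r \<and> upper_set r D \<and> (\<forall>y\<in>D \<inter> B. \<forall>h\<in>B - D. strictly_below r h y)"

lemma stage_below:
  "stage D \<Longrightarrow> y \<in> D \<Longrightarrow> y \<in> B \<Longrightarrow> h \<in> B \<Longrightarrow> h \<notin> D \<Longrightarrow> strictly_below r h y"
  by (simp add: stage_def)

lemma stage_upper: "stage D \<Longrightarrow> y \<in> D \<Longrightarrow> strictly_below r y h \<Longrightarrow> h \<in> D"
  unfolding stage_def upper_set_def by blast

text \<open>Provides the condition \<open>module\<close> above. If \<open>y\<close> is in the
  ladder, \<open>D\<close> consists there of whole rungs. If \<open>y\<close> is in the forest, so
  are \<open>h\<close> and \<open>b\<close>, and the chain condition leaves \<open>h\<close> below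
  \<open>y\<close>, because \<open>y\<close> below \<open>h\<close> would put \<open>h\<close> into
  the upper set \<open>D\<close>.\<close>

lemma stage_module:
  assumes "stage D" "strictly_below r b h" "strictly_below r b y" "h \<notin> D" "y \<in> D"
  shows "strictly_below r h y"
proof -
  have hy: "h \<in> A \<union> B" "y \<in> A \<union> B"
    using below_Field[OF assms(2)] below_Field[OF assms(3)] unfolding Field by simp_all
  show ?thesis
  proof (cases "y \<in> B")
    case True
    show ?thesis
    proof (cases "h \<in> B")
      case True
      show ?thesis
        by (rule stage_below[OF assms(1,5) \<open>y \<in> B\<close> True assms(4)])
    next
      case False
      then show ?thesis
        using hy(1) \<open>y \<in> B\<close> by (intro below) auto
    qed
  next
    case False
    then have y: "y \<in> A"
      using hy by blast
    have h: "h \<in> A"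
    proof (rule ccontr)
      assume "h \<notin> A"
      then have "strictly_below r y h"
        using hy(1) y by (intro below) auto
      then show False
        using stage_upper[OF assms(1,5)] assms(4) by simp
    qed
    have "b \<in> A"
      using below_notin_B[OF assms(3) y] below_Field[OF assms(3)] unfolding Field by simp
    from forest[OF this h y assms(2,3)] show ?thesis
      using assms(4,5) stage_upper[OF assms(1,5), of h] by auto
  qed
qed

lemma stage_preserved:
  assumes "stage D" "b \<in> Field r" "w \<in> linear_extensions r" "w' \<in> linear_extensions r"
    and "filter (\<lambda>a. a \<in> D) w = filter (\<lambda>a. a \<in> D) w'"
  shows "filter (\<lambda>a. a \<in> D) (promote_letter r b w) = filter (\<lambda>a. a \<in> D) (promote_letter r b w')"
proof -
  have up: "upper_set r D"
    using assms(1) by (simp add: stage_def)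
  show ?thesis
    using filter_promote_letter[OF up trans_r antisym_r stage_module[OF assms(1)] assms(3,2)]
      filter_promote_letter[OF up trans_r antisym_r stage_module[OF assms(1)] assms(4,2)] assms(5)
    by simp
qed

lemma stage_grows:
  assumes "stage D" "D \<noteq> Field r"
  obtains a D' where "a \<in> Field r" "stage D'" "D \<subset> D'"
    "\<And>w w'. w \<in> linear_extensions r \<Longrightarrow> w' \<in> linear_extensions r \<Longrightarrow>
      filter (\<lambda>a. a \<in> D) w = filter (\<lambda>a. a \<in> D) w' \<Longrightarrow>
      filter (\<lambda>a. a \<in> D') (promote_letter r a w) = filter (\<lambda>a. a \<in> D') (promote_letter r a w')"
proof (cases "B \<subseteq> D")
  case True
  \<comment> \<open>Only forest letters are missing here, and the rung condition in
    \<open>stage\<close> is vacuous.\<close>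
  have D: "D \<subseteq> Field r" "upper_set r D"
    using assms(1) by (simp_all add: stage_def)
  obtain a where a: "a \<in> Field r - D" "\<And>b. b \<in> Field r - D \<Longrightarrow> \<not> strictly_below r a b"
    using maximal_exists[of "Field r - D"] assms(2) D by blast
  have up: "upper_set r (insert a D)"
    unfolding upper_set_def
  proof (intro ballI allI impI)
    fix b y assume "b \<in> insert a D" "strictly_below r b y"
    then show "y \<in> insert a D"
      using stage_upper[OF assms(1), of b y] a(2)[of y] below_Field[of b y] by blast
  qed
  then have "stage (insert a D)"
    using a D True unfolding stage_def by auto
  moreover have "filter (\<lambda>b. b \<in> insert a D) (promote_letter r a w) =
      filter (\<lambda>b. b \<in> insert a D) (promote_letter r a w')"
    if "w \<in> linear_extensions r" "w' \<in> linear_extensions r"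
      "filter (\<lambda>a. a \<in> D) w = filter (\<lambda>a. a \<in> D) w'" for w w'
    using filter_promote_insert[OF D(2) up] a that by simp
  ultimately show thesis
    using that[of a "insert a D"] a by blast
next
  case False
  have D: "D \<subseteq> Field r" "upper_set r D"
    using assms(1) by (simp_all add: stage_def)
  \<comment> \<open>A forest letter in the upper set \<open>D\<close> would force all of
    \<open>B\<close> into \<open>D\<close>.\<close>
  have DB: "D \<subseteq> B"
  proof
    fix y assume "y \<in> D"
    then show "y \<in> B"
      using D(1) False Field below[of y] stage_upper[OF assms(1), of y] by blast
  qed
  obtain a where a: "a \<in> B - D" "\<And>b. b \<in> B - D \<Longrightarrow> \<not> strictly_below r a b"
    using maximal_exists[of "B - D"] False Field by blast
  \<comment> \<open>This is the rung of \<open>a\<close>: nothing in \<open>B - D\<close> lies above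
    \<open>a\<close> by maximality, so \<open>N\<close> consists of \<open>a\<close> and letters
    incomparable to it.\<close>
  define N where "N = {c \<in> B - D. \<not> strictly_below r c a}"
  have N: "a \<in> N" "N \<inter> D = {}" "N \<subseteq> B" "N \<subseteq> Field r"
    using a below_irrefl Field by (auto simp: N_def)
  have inc: "incomparable r a c" if "c \<in> N - {a}" for c
    using that a(2)[of c] by (auto simp: N_def incomparable_def strictly_below_def)
  have "d = e" if "d \<in> N - {a}" "e \<in> N - {a}" for d e
    using width[of a d e] inc[OF that(1)] inc[OF that(2)] that a(1) N(3) by blast
  \<comment> \<open>If the rung is just \<open>{a}\<close>, then \<open>c\<close> is an arbitrary
    dummy.\<close>
  then obtain c where c: "N - {a} \<subseteq> {c}"
    by blast
  have ND: "strictly_below r b y" if "b \<in> N" "y \<in> D" for b y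
    using that stage_below[OF assms(1), of y b] DB by (auto simp: N_def)
  have up: "upper_set r (N \<union> D)"
    unfolding upper_set_def
  proof (intro ballI allI impI)
    fix b y assume b: "b \<in> N \<union> D" and less: "strictly_below r b y"
    have bB: "b \<in> B"
      using b DB N(3) by blast
    have yB: "y \<in> B"
      using below_notin_B[OF less] bB below_Field[OF less] Field by blast
    show "y \<in> N \<union> D"
      using b less bB yB a(1) weak[of a b y] a(2)[of y]
        stage_upper[OF assms(1), of b y] by (auto simp: N_def)
  qed
  have "stage (N \<union> D)"
    unfolding stage_def
  proof (intro conjI ballI up)
    show "N \<union> D \<subseteq> Field r"
      using N D by auto
  next
    fix y h assume "y \<in> (N \<union> D) \<inter> B" "h \<in> B - (N \<union> D)"
    then show "strictly_below r h y"
      using stage_below[OF assms(1), of y h] weak[of y h a] a(1) by (auto simp: N_def)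
  qed
  moreover have "filter (\<lambda>b. b \<in> N \<union> D) (promote_letter r a w) =
      filter (\<lambda>b. b \<in> N \<union> D) (promote_letter r a w')"
    if "w \<in> linear_extensions r" "w' \<in> linear_extensions r"
      "filter (\<lambda>a. a \<in> D) w = filter (\<lambda>a. a \<in> D) w'" for w w'
    using filter_promote_rung[OF up N(1,2,4) ND inc c] that by simp
  ultimately show thesis
    using that[of a "N \<union> D"] a N Field by blast
qed

end

lemma finite_linear_extensions:
  assumes "finite (Field r)"
  shows "finite (linear_extensions r)"
  by (rule finite_subset[OF _ finite_subset_distinct[OF assms]]) (auto simp: linear_extensions_iff)

section \<open>Rooted forests and ladders satisfy the order conditions of the locale\<close>

text \<open>A minimal element among those above \<open>b\<close> and weakly below \<open>h\<close>
  is a cover of \<open>b\<close>.\<close>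

lemma covered_by_exists:
  assumes "Partial_order t" "finite (Field t)" "strictly_below t b h"
  obtains c where "covered_by t b c" "(c, h) \<in> t"
proof -
  let ?M = "{z. strictly_below t b z \<and> (z, h) \<in> t}"
  have tr: "trans t" and as: "antisym t" and rf: "refl_on (Field t) t"
    using assms(1) by (auto simp: partial_order_on_def preorder_on_def)
  have sub: "?M \<subseteq> Field t"
    by (auto simp: strictly_below_def Field_def)
  have hM: "h \<in> ?M"
    using assms(3) rf by (auto simp: strictly_below_def Field_def refl_on_def)
  have "\<exists>c\<in>?M. \<forall>z\<in>?M. z \<noteq> c \<longrightarrow> \<not> strictly_below t z c"
  proof (intro Finite_Set.bex_min_element finite_subset[OF sub assms(2)])
    show "asymp_on ?M (strictly_below t)"
      using as by (auto simp: asymp_on_def strictly_below_def dest: antisymD)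
    show "transp_on ?M (strictly_below t)"
      using tr as unfolding transp_on_def strictly_below_def by (metis antisymD transD)
    show "?M \<noteq> {}"
      using hM by blast
  qed
  then obtain c where c: "c \<in> ?M" "\<And>z. z \<in> ?M \<Longrightarrow> z \<noteq> c \<Longrightarrow> \<not> strictly_below t z c"
    by blast
  have "covered_by t b c"
    unfolding covered_by_def
  proof (intro conjI notI)
    assume "\<exists>z. strictly_below t b z \<and> strictly_below t z c"
    then obtain z where z: "strictly_below t b z" "strictly_below t z c"
      by blast
    have "(z, h) \<in> t"
      using z(2) c(1) tr by (auto simp: strictly_below_def dest: transD)
    then show False
      using c(2)[of z] z by (auto simp: strictly_below_def)
  qed (use c in auto)
  then show thesis
    using that c(1) by blast
qed

text \<open>Both \<open>h\<close> and \<open>y\<close> lie weakly above the unique cover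
  \<open>c\<close> of \<open>b\<close>. Either \<open>c\<close> is one of them, or the claim passes
  from \<open>b\<close> to \<open>c\<close>, which has fewer elements above it.\<close>

lemma unique_cover_chain:
  assumes "Partial_order t" "finite (Field t)" "\<And>a. a \<in> Field t \<Longrightarrow> \<exists>\<^sub>\<le>\<^sub>1 b. covered_by t a b"
    and "strictly_below t b h" "strictly_below t b y"
  shows "(h, y) \<in> t \<or> (y, h) \<in> t"
  using assms(4,5)
proof (induction "card {z. strictly_below t b z}" arbitrary: b rule: less_induct)
  case less
  have tr: "trans t" and as: "antisym t"
    using assms(1) by (auto simp: partial_order_on_def preorder_on_def)
  obtain c where c: "covered_by t b c" "(c, h) \<in> t"
    using covered_by_exists[OF assms(1,2) less.prems(1)] by blast
  obtain c' where c': "covered_by t b c'" "(c', y) \<in> t"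
    using covered_by_exists[OF assms(1,2) less.prems(2)] by blast
  have "b \<in> Field t"
    using less.prems by (auto simp: strictly_below_def Field_def)
  then have cc: "c' = c"
    using assms(3) c c' by (meson Uniq_D)
  show ?case
  proof (cases "c = h \<or> c = y")
    case False
    have bc: "strictly_below t b c"
      using c by (simp add: covered_by_def)
    have "{z. strictly_below t c z} \<subseteq> {z. strictly_below t b z}"
      using bc tr as by (auto simp: strictly_below_def dest: transD antisymD)
    moreover have "c \<in> {z. strictly_below t b z} - {z. strictly_below t c z}"
      using bc by (auto simp: strictly_below_def)
    moreover have "finite {z. strictly_below t b z}"
      by (rule finite_subset[OF _ assms(2)]) (auto simp: strictly_below_def Field_def)
    ultimately have "card {z. strictly_below t c z} < card {z. strictly_below t b z}"
      by (intro psubset_card_mono) auto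
    moreover have "strictly_below t c h" "strictly_below t c y"
      using False c(2) c'(2) cc by (auto simp: strictly_below_def)
    ultimately show ?thesis
      by (rule less.hyps)
  qed (use c c' cc in auto)
qed

text \<open>The trees have disjoint ground sets, so \<open>b\<close> determines the tree containing
  both relations.\<close>

lemma rooted_forest_chain:
  assumes "rooted_forest F" "finite (Field F)" "strictly_below F b h" "strictly_below F b y"
  shows "(h, y) \<in> F \<or> (y, h) \<in> F"
proof -
  obtain T where T: "\<forall>t\<in>T. rooted_tree t" "pairwise (\<lambda>s t. disjnt (Field s) (Field t)) T" "F = \<Union>T"
    using assms(1) unfolding rooted_forest_def by blast
  obtain t t' where t: "t \<in> T" "strictly_below t b h" and t': "t' \<in> T" "strictly_below t' b y"
    using assms(3,4) T(3) by (auto simp: strictly_below_def)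
  have "b \<in> Field t" "b \<in> Field t'"
    using t t' by (auto simp: strictly_below_def Field_def)
  then have "t' = t"
    using T(2) t(1) t'(1) by (auto simp: pairwise_def disjnt_def)
  moreover have "finite (Field t)"
    using finite_subset[OF _ assms(2), of "Field t"] t(1) T(3) by (auto simp: Field_def)
  ultimately have "(h, y) \<in> t \<or> (y, h) \<in> t"
    using unique_cover_chain[of t b h y] T(1) t t' by (auto simp: rooted_tree_def)
  then show ?thesis
    using t(1) T(3) by blast
qed

lemma Field_ordinal_sum: "Field (ordinal_sum r s) = Field r \<union> Field s"
  by (auto simp: ordinal_sum_def Field_def)

lemma strictly_below_ordinal_sum:
  assumes "Field r \<inter> Field s = {}"
  shows "strictly_below (ordinal_sum r s) a b \<longleftrightarrow>
    strictly_below r a b \<or> strictly_below s a b \<or> a \<in> Field r \<and> b \<in> Field s"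
  using assms by (auto simp: ordinal_sum_def strictly_below_def)

text \<open>No strict relation ends in the new bottom rung. So \<open>y\<close> is in the old part,
  and an \<open>a\<close> from the new rung lies below \<open>y\<close>.\<close>

lemma ladder_weak:
  assumes "ladder L" "a \<in> Field L" "strictly_below L c y"
  shows "strictly_below L c a \<or> strictly_below L a y"
  using assms
proof (induction arbitrary: a c y rule: ladder.induct)
  case (ladder_step A r)
  have disj: "Field (Id_on A) \<inter> Field r = {}"
    using ladder_step by (auto simp: Field_def)
  show ?case
    using ladder_step.IH[of a c y] ladder_step.prems
    unfolding strictly_below_ordinal_sum[OF disj] Field_ordinal_sum
    by (auto simp: strictly_below_def Field_def)
qed simp

text \<open>Incomparable elements share a rung, and three distinct elements do not fit into
  one.\<close>

lemma ladder_width: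
  assumes "ladder L" "a \<in> Field L" "c \<in> Field L" "d \<in> Field L" "incomparable L a c" "incomparable L a d"
  shows "c = d"
  using assms
proof (induction arbitrary: a c d rule: ladder.induct)
  case (ladder_step A r)
  have F: "Field (Id_on A) = A"
    by (auto simp: Field_def)
  have mem: "c \<in> A \<longleftrightarrow> a \<in> A" "d \<in> A \<longleftrightarrow> a \<in> A"
    using ladder_step.prems ladder_step.hyps(3)
    unfolding Field_ordinal_sum F unfolding incomparable_def ordinal_sum_def F by blast+
  show ?case
  proof (cases "a \<in> A")
    case True
    show ?thesis
    proof (rule ccontr)
      assume "c \<noteq> d"
      moreover have "c \<noteq> a" "d \<noteq> a"
        using ladder_step.prems True by (auto simp: incomparable_def ordinal_sum_def)
      ultimately have "card {a, c, d} = 3"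
        by auto
      \<comment> \<open>Infinite sets have cardinality 0, which is neither 1 nor 2.\<close>
      moreover have "finite A"
        using ladder_step.hyps(1) card.infinite by fastforce
      then have "card {a, c, d} \<le> card A"
        using mem True by (intro card_mono) auto
      ultimately show False
        using ladder_step.hyps(1) by auto
    qed
  next
    case False
    then show ?thesis
      using ladder_step.IH[of a c d] ladder_step.prems mem
      unfolding Field_ordinal_sum F unfolding incomparable_def ordinal_sum_def F by blast
  qed
qed simp

lemma forest_ladder_ordinal_sum:
  assumes "Partial_order (ordinal_sum F L)" "finite (Field F \<union> Field L)"
    and disj: "Field F \<inter> Field L = {}" and "rooted_forest F" "ladder L"
  shows "forest_ladder (ordinal_sum F L) (Field F) (Field L)"
proof
  have F: "strictly_below (ordinal_sum F L) a b \<longleftrightarrow> strictly_below F a b"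
    if "b \<in> Field F" for a b
    using that disj unfolding strictly_below_ordinal_sum[OF disj]
    by (auto simp: strictly_below_def Field_def)
  have L: "(a, b) \<in> ordinal_sum F L \<longleftrightarrow> (a, b) \<in> L" if "a \<in> Field L" for a b
    using that disj unfolding ordinal_sum_def by (auto simp: Field_def)
  show "h = y \<or> strictly_below (ordinal_sum F L) h y \<or> strictly_below (ordinal_sum F L) y h"
    if "h \<in> Field F" "y \<in> Field F"
      "strictly_below (ordinal_sum F L) b h" "strictly_below (ordinal_sum F L) b y" for b h y
    using rooted_forest_chain[of F b h y] that assms unfolding F[OF that(1)] F[OF that(2)]
    by (auto simp: strictly_below_def)
  show "strictly_below (ordinal_sum F L) c a \<or> strictly_below (ordinal_sum F L) a y"
    if "a \<in> Field L" "c \<in> Field L" "strictly_below (ordinal_sum F L) c y" for a c y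
    using ladder_weak[of L a c y] that assms(5) by (auto simp: strictly_below_def L)
  show "c = d"
    if "a \<in> Field L" "c \<in> Field L" "d \<in> Field L"
      "incomparable (ordinal_sum F L) a c" "incomparable (ordinal_sum F L) a d" for a c d
    using ladder_width[of L a c d] that assms(5) by (auto simp: incomparable_def L)
  show "finite (Field (ordinal_sum F L))"
    using assms(2) by (simp add: Field_ordinal_sum)
  show "strictly_below (ordinal_sum F L) a b" if "a \<in> Field F" "b \<in> Field L" for a b
    using that by (simp add: strictly_below_ordinal_sum[OF disj])
qed (rule assms(1) Field_ordinal_sum disj)+

section \<open>Total variation bounds\<close>

lemma tv_distance_same [simp]: "tv_distance S D D = 0"
  by (simp add: tv_distance_def)

lemma sum_pmf_le_1: "finite S \<Longrightarrow> (\<Sum>s\<in>S. pmf D s) \<le> 1"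
  by (metis measure_measure_pmf_finite measure_pmf.prob_le_1)

lemma tv_distance_le_1:
  assumes "finite S"
  shows "tv_distance S D D' \<le> 1"
proof -
  have "(\<Sum>s\<in>S. \<bar>pmf D s - pmf D' s\<bar>) \<le> (\<Sum>s\<in>S. pmf D s + pmf D' s)"
    by (intro sum_mono) (auto simp: abs_le_iff intro: add_increasing add_increasing2)
  also have "\<dots> \<le> 1 + 1"
    unfolding sum.distrib by (intro add_mono sum_pmf_le_1 assms)
  finally show ?thesis
    by (simp add: tv_distance_def)
qed

text \<open>Convexity under common weights. It plays the role of the coupling: both copies receive
  the same letter \<open>a\<close> with weight \<open>c a\<close>.\<close>

lemma tv_distance_mixture:
  assumes "\<And>a. a \<in> A \<Longrightarrow> 0 \<le> c a"
    and "\<And>s. pmf D s = (\<Sum>a\<in>A. c a * pmf (f a) s)"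
    and "\<And>s. pmf D' s = (\<Sum>a\<in>A. c a * pmf (g a) s)"
  shows "tv_distance S D D' \<le> (\<Sum>a\<in>A. c a * tv_distance S (f a) (g a))"
proof -
  have "\<bar>pmf D s - pmf D' s\<bar> \<le> (\<Sum>a\<in>A. c a * \<bar>pmf (f a) s - pmf (g a) s\<bar>)" for s
  proof -
    have "\<bar>pmf D s - pmf D' s\<bar> = \<bar>\<Sum>a\<in>A. c a * (pmf (f a) s - pmf (g a) s)\<bar>"
      by (simp add: assms sum_subtractf right_diff_distrib)
    also have "\<dots> \<le> (\<Sum>a\<in>A. \<bar>c a * (pmf (f a) s - pmf (g a) s)\<bar>)"
      by (rule sum_abs)
    finally show ?thesis
      using assms(1) by (simp add: abs_mult)
  qed
  then have "(\<Sum>s\<in>S. \<bar>pmf D s - pmf D' s\<bar>) \<le> (\<Sum>s\<in>S. \<Sum>a\<in>A. c a * \<bar>pmf (f a) s - pmf (g a) s\<bar>)"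
    by (intro sum_mono)
  also have "\<dots> = (\<Sum>a\<in>A. c a * (\<Sum>s\<in>S. \<bar>pmf (f a) s - pmf (g a) s\<bar>))"
    by (subst sum.swap) (simp add: sum_distrib_left)
  finally have "tv_distance S D D' \<le> 1 / 2 * (\<Sum>a\<in>A. c a * (\<Sum>s\<in>S. \<bar>pmf (f a) s - pmf (g a) s\<bar>))"
    by (simp add: tv_distance_def)
  also have "\<dots> = (\<Sum>a\<in>A. c a * tv_distance S (f a) (g a))"
    unfolding tv_distance_def sum_distrib_left[of _ _ A] by (simp only: mult.left_commute)
  finally show ?thesis .
qed

section \<open>Decomposition of the chain by its first step\<close>

lemma pmf_bind_finite:
  assumes "finite A" "set_pmf M \<subseteq> A"
  shows "pmf (bind_pmf M f) s = (\<Sum>a\<in>A. pmf M a * pmf (f a) s)"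
  unfolding pmf_bind using assms by (subst integral_measure_pmf[of A]) auto

lemma chain_funpow_bind:
  fixes K :: "'s \<Rightarrow> 's pmf"
  shows "((\<lambda>D. bind_pmf D K) ^^ k) (bind_pmf M f) = bind_pmf M (\<lambda>t. ((\<lambda>D. bind_pmf D K) ^^ k) (f t))"
proof (induction k)
  case (Suc k)
  then show ?case
    by (simp only: funpow.simps o_apply bind_assoc_pmf)
qed (simp only: funpow.simps id_apply)

lemma chain_funpow:
  "((\<lambda>D. bind_pmf D K) ^^ k) M = bind_pmf M (\<lambda>t. chain_distribution K t k)"
  using chain_funpow_bind[of k K M return_pmf] by (simp add: bind_return_pmf' chain_distribution_def)

lemma chain_distribution_0 [simp]: "chain_distribution K s 0 = return_pmf s"
  by (simp add: chain_distribution_def)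

text \<open>The definition appends each step at the end, whereas the coupling argument conditions on
  the first letter.\<close>

lemma chain_distribution_Suc:
  "chain_distribution K s (Suc k) = bind_pmf (K s) (\<lambda>t. chain_distribution K t k)"
  unfolding chain_distribution_def[of K s] funpow_Suc_right o_def bind_return_pmf
  by (rule chain_funpow)

lemma stationary_chain:
  assumes "stationary_distribution S K \<omega>"
  shows "bind_pmf \<omega> (\<lambda>t. chain_distribution K t k) = \<omega>"
proof -
  have "bind_pmf \<omega> K = \<omega>"
    using assms by (simp add: stationary_distribution_def)
  then have "((\<lambda>D. bind_pmf D K) ^^ k) \<omega> = \<omega>"
    by (induction k) auto
  then show ?thesis
    by (simp add: chain_funpow)
qed

text \<open>Reindexing positions by letters makes the weights \<open>x a\<close> independent of the
  word, so that two words can share the random letter.\<close>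

lemma pmf_bind_promotion_kernel:
  assumes "w \<in> linear_extensions r" "\<And>a. a \<in> Field r \<Longrightarrow> 0 \<le> x a" "(\<Sum>a\<in>Field r. x a) = 1"
  shows "pmf (bind_pmf (promotion_kernel r x w) f) s =
    (\<Sum>a\<in>Field r. x a * pmf (f (promote_letter r a w)) s)"
proof -
  have w: "distinct w" "set w = Field r"
    using assms(1) by (auto simp: linear_extensions_iff)
  have pmf: "pmf (position_pmf x w) i = (if i \<in> {1..length w} then x (w ! (i - 1)) else 0)" for i
    using pmf_position_pmf[of w x] w assms by auto
  then have "set_pmf (position_pmf x w) \<subseteq> {1..length w}"
    by (auto simp: set_pmf_iff split: if_splits)
  then have "pmf (bind_pmf (promotion_kernel r x w) f) s =
      (\<Sum>i\<in>{1..length w}. pmf (position_pmf x w) i * pmf (f (promotion r i w)) s)"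
    unfolding promotion_kernel_def bind_map_pmf by (intro pmf_bind_finite) auto
  also have "\<dots> = (\<Sum>i<length w. x (w ! i) * pmf (f (promotion r (Suc i) w)) s)"
    by (rule sum.reindex_bij_witness[where i = Suc and j = "\<lambda>i. i - 1"]) (auto simp: pmf)
  also have "\<dots> = (\<Sum>i<length w. x (w ! i) * pmf (f (promote_letter r (w ! i) w)) s)"
    using w by (intro sum.cong) (auto simp: promotion_eq_promote_letter)
  also have "\<dots> = (\<Sum>a\<in>Field r. x a * pmf (f (promote_letter r a w)) s)"
    using sum.reindex_bij_betw[OF bij_betw_nth[OF w(1) refl w(2)[symmetric]],
        of "\<lambda>a. x a * pmf (f (promote_letter r a w)) s"] .
  finally show ?thesis .
qed

section \<open>Analytic estimates for the exponential moment bound\<close>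

text \<open>The difference of the two sides vanishes at 1 and has derivative
  \<open>(1 - 1 / v)\<^sup>2 / 2\<close>.\<close>

lemma ln_le_half_diff:
  fixes u :: real
  assumes "1 \<le> u"
  shows "ln u \<le> (u - 1 / u) / 2"
proof -
  have "(1 - 1 / 1) / 2 - ln (1::real) \<le> (u - 1 / u) / 2 - ln u"
  proof (rule DERIV_nonneg_imp_nondecreasing[OF assms])
    fix v :: real assume v: "1 \<le> v" "v \<le> u"
    have "((\<lambda>v. (v - 1 / v) / 2 - ln v) has_real_derivative (1 - 1 / v)\<^sup>2 / 2) (at v)"
      using v by (auto intro!: derivative_eq_intros simp: field_simps power2_eq_square)
    then show "\<exists>d. ((\<lambda>v. (v - 1 / v) / 2 - ln v) has_real_derivative d) (at v) \<and> 0 \<le> d"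
      by (meson zero_le_divide_iff zero_le_power2 zero_le_numeral)
  qed
  then show ?thesis
    by simp
qed

lemma power_le_exp:
  fixes p z :: real
  assumes "0 \<le> p" "p \<le> 1" "0 \<le> z"
  shows "(1 - p + p * z) ^ k \<le> exp (- (real k * p * (1 - z)))"
proof -
  have "0 \<le> p * z"
    using assms by simp
  then have "(1 - p + p * z) ^ k \<le> exp (- (p * (1 - z))) ^ k"
    using assms(2) exp_ge_add_one_self[of "- (p * (1 - z))"]
    by (intro power_mono) (simp_all add: algebra_simps)
  also have "\<dots> = exp (- (real k * p * (1 - z)))"
    by (simp flip: exp_of_nat_mult add: mult_ac)
  finally show ?thesis .
qed

lemma chernoff_optimum:
  fixes d p :: real
  assumes bound: "\<And>z. 0 < z \<Longrightarrow> z \<le> 1 \<Longrightarrow> d \<le> (1 / z) ^ m * (1 - p + p * z) ^ k"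
    and p: "0 < p" "p \<le> 1" and k: "real m \<le> real k * p"
  shows "d \<le> exp (- ((real k * p - real m)\<^sup>2 / (2 * real k * p)))"
proof (cases "m = 0")
  case True
  \<comment> \<open>The minimiser would be 0, which is not allowed; \<open>1 / 2\<close> already
    gives the required exponent, half of \<open>real k * p\<close>.\<close>
  have "d \<le> exp (- (real k * p * (1 - 1 / 2)))"
    using bound[of "1 / 2"] power_le_exp[of p "1 / 2" k] p True by auto
  also have "\<dots> = exp (- ((real k * p - real m)\<^sup>2 / (2 * real k * p)))"
    using p True by (simp add: power2_eq_square field_simps)
  finally show ?thesis .
next
  case False
  define M where "M = real k * p"
  \<comment> \<open>This minimises \<open>(1 / z) ^ m * exp (- (M * (1 - z)))\<close> over positive
    \<open>z\<close>.\<close>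
  define z where "z = real m / M"
  have M: "0 < M"
    using False k by (simp add: M_def)
  have z: "0 < z" "z \<le> 1"
    using False M k by (auto simp: z_def M_def)
  note bound[OF z]
  also have "(1 / z) ^ m * (1 - p + p * z) ^ k \<le> (1 / z) ^ m * exp (- (M * (1 - z)))"
    using power_le_exp[of p z k] p z by (intro mult_left_mono) (simp_all add: M_def)
  also have "(1 / z) ^ m = exp (real m * ln (1 / z))"
    using z by (simp add: exp_of_nat_mult)
  also have "exp (real m * ln (1 / z)) * exp (- (M * (1 - z))) =
      exp (real m * ln (1 / z) - M * (1 - z))"
    by (simp flip: exp_add)
  also have "\<dots> \<le> exp (- ((M - real m)\<^sup>2 / (2 * M)))"
  proof -
    have "real m * ln (1 / z) \<le> real m * ((1 / z - z) / 2)"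
      using ln_le_half_diff[of "1 / z"] z by (intro mult_left_mono) auto
    \<comment> \<open>For this \<open>z\<close> the left-hand side is
      \<open>(M - m\<^sup>2 / M) / 2 - (M - m)\<close>, which is minus a perfect square over
      \<open>2 * M\<close>.\<close>
    also have "\<dots> - M * (1 - z) = - ((M - real m)\<^sup>2 / (2 * M))"
      using M False by (simp add: z_def field_simps power2_eq_square)
    finally show ?thesis
      by simp
  qed
  finally show ?thesis
    by (simp add: M_def mult.assoc)
qed

section \<open>Coupling bound and comparison with the stationary distribution\<close>

context forest_ladder
begin

text \<open>Induction on the time. A successful letter has weight at least \<open>p\<close> and
  saves a factor \<open>z\<close>, so a step costs at most \<open>1 - p + p * z\<close>. The leading
  \<open>z\<close> is affordable because the distance is 0 once \<open>D\<close> is everything,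
  while otherwise the power of \<open>1 / z\<close> has exponent at least 1.\<close>

lemma tv_distance_stage:
  fixes x :: "'a \<Rightarrow> real" and p z :: real
  assumes x: "\<And>a. a \<in> Field r \<Longrightarrow> p \<le> x a" "(\<Sum>a\<in>Field r. x a) = 1" and p: "0 \<le> p"
    and z: "0 < z" "z \<le> 1"
    and "stage D" "w \<in> linear_extensions r" "w' \<in> linear_extensions r"
      "filter (\<lambda>a. a \<in> D) w = filter (\<lambda>a. a \<in> D) w'"
  shows "tv_distance (linear_extensions r) (chain_distribution (promotion_kernel r x) w k)
      (chain_distribution (promotion_kernel r x) w' k)
    \<le> z * (1 / z) ^ card (Field r - D) * (1 - p + p * z) ^ k"
  using assms(6-)
proof (induction k arbitrary: D w w')
  case 0
  show ?case
  proof (cases "D = Field r")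
    case True
    then have "w = w'"
      using 0 by (metis (no_types, lifting) filter_True linear_extensions_iff)
    then show ?thesis
      using z by simp
  next
    case False
    then have "0 < card (Field r - D)"
      using 0 finite_Field by (auto simp: stage_def card_gt_0_iff)
    then have "1 \<le> z * (1 / z) ^ card (Field r - D)"
      using z one_le_power[of "1 / z" "card (Field r - D) - 1"] by (cases "card (Field r - D)") auto
    then show ?thesis
      using order_trans[OF tv_distance_le_1[OF finite_linear_extensions[OF finite_Field]]] by simp
  qed
next
  case (Suc k)
  let ?T = "\<lambda>w w' k. tv_distance (linear_extensions r)
    (chain_distribution (promotion_kernel r x) w k) (chain_distribution (promotion_kernel r x) w' k)"
  let ?q = "1 - p + p * z"
  define j where "j = card (Field r - D)"
  show ?case
  proof (cases "D = Field r")
    case True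
    then have "w = w'"
      using Suc.prems by (metis (no_types, lifting) filter_True linear_extensions_iff)
    \<comment> \<open>This makes the bound nonnegative, which suffices because the two copies
      coincide.\<close>
    moreover have "p \<le> 1"
    proof (cases "Field r = {}")
      case False
      then obtain a where "a \<in> Field r"
        by blast
      then show ?thesis
        using x p member_le_sum[of a "Field r" x] finite_Field by force
    qed (use x in auto)
    ultimately show ?thesis
      using z p by simp
  next
    case False
    obtain b D' where b: "b \<in> Field r" "stage D'" "D \<subset> D'"
      and grow: "\<And>w w'. w \<in> linear_extensions r \<Longrightarrow> w' \<in> linear_extensions r \<Longrightarrow>
        filter (\<lambda>a. a \<in> D) w = filter (\<lambda>a. a \<in> D) w' \<Longrightarrow>
        filter (\<lambda>a. a \<in> D') (promote_letter r b w) = filter (\<lambda>a. a \<in> D') (promote_letter r b w')"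
      using stage_grows[OF Suc.prems(1) False] by metis
    have x0: "0 \<le> x a" if "a \<in> Field r" for a
      using x(1)[OF that] p by simp
    have xb: "x b \<le> 1"
      using x(2) x0 b(1) member_le_sum[of b "Field r" x] finite_Field by simp
    then have q: "0 \<le> ?q"
      using x(1)[OF b(1)] p z by simp
    have "card (Field r - D') < j"
      unfolding j_def using b finite_Field Suc.prems(1)
      by (intro psubset_card_mono) (auto simp: stage_def)
    \<comment> \<open>An inequality, since a whole rung may add two letters to \<open>D\<close> at
      once.\<close>
    then obtain i where i: "j = Suc i" "card (Field r - D') \<le> i"
      by (cases j) auto
    \<comment> \<open>As \<open>j = Suc i\<close>, this is \<open>z * (1 / z) ^ j * ?q ^ k\<close>,
      the bound for a letter without progress.\<close>
    let ?c = "(1 / z) ^ i * ?q ^ k"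
    have same: "?T (promote_letter r a w) (promote_letter r a w') k \<le> ?c"
      if "a \<in> Field r" for a
      using Suc.IH[OF Suc.prems(1) promote_letter_linear_extension[OF Suc.prems(2) that]
          promote_letter_linear_extension[OF Suc.prems(3) that]
          stage_preserved[OF Suc.prems(1) that Suc.prems(2-4)]] z i
      by (simp add: j_def)
    have "?T (promote_letter r b w) (promote_letter r b w') k
        \<le> z * (1 / z) ^ card (Field r - D') * ?q ^ k"
      using Suc.IH[OF b(2) promote_letter_linear_extension[OF Suc.prems(2) b(1)]
          promote_letter_linear_extension[OF Suc.prems(3) b(1)] grow[OF Suc.prems(2-4)]] .
    also have "\<dots> \<le> z * (1 / z) ^ i * ?q ^ k"
      using z q i by (intro mult_right_mono mult_left_mono power_increasing) auto
    finally have better: "?T (promote_letter r b w) (promote_letter r b w') k \<le> z * ?c"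
      by (simp add: mult.assoc)
    have c: "0 \<le> ?c"
      using z q by simp
    have "?T w w' (Suc k) \<le>
        (\<Sum>a\<in>Field r. x a * ?T (promote_letter r a w) (promote_letter r a w') k)"
      unfolding chain_distribution_Suc using Suc.prems x0 x(2)
      by (intro tv_distance_mixture pmf_bind_promotion_kernel) auto
    also have "\<dots> = x b * ?T (promote_letter r b w) (promote_letter r b w') k +
        (\<Sum>a\<in>Field r - {b}. x a * ?T (promote_letter r a w) (promote_letter r a w') k)"
      using finite_Field b(1) by (rule sum.remove)
    also have "\<dots> \<le> x b * (z * ?c) + (\<Sum>a\<in>Field r - {b}. x a * ?c)"
      using better same x0 b(1) by (intro add_mono mult_left_mono sum_mono) auto
    also have "(\<Sum>a\<in>Field r - {b}. x a * ?c) = (1 - x b) * ?c"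
      using x(2) sum.remove[OF finite_Field b(1), of x] by (simp flip: sum_distrib_right)
    also have "x b * (z * ?c) + (1 - x b) * ?c = ?c - x b * ((1 - z) * ?c)"
      by (simp add: algebra_simps)
    \<comment> \<open>The expression decreases in the success weight \<open>x b\<close>, which is at
      least \<open>p\<close>.\<close>
    also have "\<dots> \<le> ?c - p * ((1 - z) * ?c)"
      using x(1)[OF b(1)] z c by (intro diff_left_mono mult_right_mono mult_nonneg_nonneg[OF _ c]) simp_all
    also have "\<dots> = ?c * ?q"
      by (simp add: algebra_simps)
    also have "\<dots> = z * (1 / z) ^ j * ?q ^ Suc k"
      using z i by simp
    finally show ?thesis
      by (simp add: j_def)
  qed
qed

text \<open>By stationarity \<open>\<omega>\<close> is the mixture of the chains started from its
  own states, and any two words agree on the empty stage.\<close>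

lemma tv_distance_stationary:
  fixes x :: "'a \<Rightarrow> real" and p z :: real
  assumes "\<And>a. a \<in> Field r \<Longrightarrow> p \<le> x a" "(\<Sum>a\<in>Field r. x a) = 1" "0 \<le> p" "0 < z" "z \<le> 1"
    and w: "w \<in> linear_extensions r"
    and \<omega>: "stationary_distribution (linear_extensions r) (promotion_kernel r x) \<omega>"
  shows "tv_distance (linear_extensions r) (chain_distribution (promotion_kernel r x) w k) \<omega>
    \<le> z * (1 / z) ^ card (Field r) * (1 - p + p * z) ^ k"
proof -
  let ?S = "linear_extensions r"
  let ?C = "\<lambda>w. chain_distribution (promotion_kernel r x) w k"
  let ?c = "z * (1 / z) ^ card (Field r) * (1 - p + p * z) ^ k"
  have fin: "finite ?S"
    by (intro finite_linear_extensions finite_Field)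
  have supp: "set_pmf \<omega> \<subseteq> ?S"
    using \<omega> by (simp add: stationary_distribution_def)
  have sum1: "(\<Sum>v\<in>?S. pmf \<omega> v) = 1"
    by (rule sum_pmf_eq_1[OF fin supp])
  have "stage {}"
    by (simp add: stage_def upper_set_def)
  have "tv_distance ?S (?C w) \<omega> \<le> (\<Sum>v\<in>?S. pmf \<omega> v * tv_distance ?S (?C w) (?C v))"
  proof (rule tv_distance_mixture)
    show "pmf (?C w) s = (\<Sum>v\<in>?S. pmf \<omega> v * pmf (?C w) s)" for s
      using sum1 by (simp flip: sum_distrib_right)
    show "pmf \<omega> s = (\<Sum>v\<in>?S. pmf \<omega> v * pmf (?C v) s)" for s
      using pmf_bind_finite[OF fin supp, of ?C s] stationary_chain[OF \<omega>, of k] by simp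
  qed simp
  also have "\<dots> \<le> (\<Sum>v\<in>?S. pmf \<omega> v * ?c)"
    using tv_distance_stage[OF assms(1-5) \<open>stage {}\<close> w, of _ k] by (intro sum_mono mult_left_mono) auto
  also have "\<dots> = ?c"
    using sum1 by (simp flip: sum_distrib_right)
  finally show ?thesis .
qed

end

theorem theorem25:
  fixes n k :: nat
    and P F L :: "nat rel"
    and x :: "nat \<Rightarrow> real"
    and p :: real
    and \<pi>\<^sub>0 :: "nat list"
    and \<omega> :: "nat list pmf"
  assumes "partial_order_on {1..n} P"
    and "P = ordinal_sum F L"
    and "Field F \<inter> Field L = {}"
    and "rooted_forest F"
    and "ladder L"
    and "\<And>i. i \<in> {1..n} \<Longrightarrow> 0 < x i"
    and "(\<Sum>i=1..n. x i) = 1"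
    and "p = Min (x ` {1..n})"
    and "\<pi>\<^sub>0 \<in> linear_extensions P"
    and "stationary_distribution (linear_extensions P) (promotion_kernel P x) \<omega>"
    and "real k \<ge> (real n - 1) / p"
  shows "tv_distance (linear_extensions P)
           (chain_distribution (promotion_kernel P x) \<pi>\<^sub>0 k) \<omega>
         \<le> exp (- ((real k * p - (real n - 1))\<^sup>2 / (2 * real k * p)))"
proof -
  have ground: "Field P = {1..n}"
    using assms(1) by (auto simp: partial_order_on_def preorder_on_def refl_on_def Field_def)
  then have "forest_ladder P (Field F) (Field L)"
    using forest_ladder_ordinal_sum[of F L] assms(1-5) Field_ordinal_sum[of F L] by simp
  then interpret forest_ladder P "Field F" "Field L" .
  have n: "n \<noteq> 0"
    using assms(7) by (intro notI) simp
  then have "p \<in> x ` {1..n}"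
    unfolding assms(8) by (intro Min_in) auto
  then have p: "0 < p"
    using assms(6) by auto
  have px: "p \<le> x i" if "i \<in> Field P" for i
    using that by (auto simp: assms(8) ground)
  have sum: "(\<Sum>i\<in>Field P. x i) = 1"
    using assms(7) by (simp add: ground)
  have "x 1 \<le> 1"
    using member_le_sum[of 1 "{1..n}" x] assms(6,7) n by (force intro: less_imp_le)
  then have "p \<le> 1"
    using px[of 1] n by (simp add: ground)
  moreover have "real (n - 1) \<le> real k * p"
    using assms(11) p n by (simp add: field_simps of_nat_diff)
  moreover have "tv_distance (linear_extensions P)
      (chain_distribution (promotion_kernel P x) \<pi>\<^sub>0 k) \<omega> \<le> (1 / z) ^ (n - 1) * (1 - p + p * z) ^ k"
    if "0 < z" "z \<le> 1" for z :: real
  proof -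
    \<comment> \<open>The leading factor \<open>z\<close> is the source of \<open>n - 1\<close> in
      place of \<open>n\<close> in the final bound.\<close>
    have "z * (1 / z) ^ n = (1 / z) ^ (n - 1)"
      using that n by (cases n) auto
    then show ?thesis
      using tv_distance_stationary[OF px sum _ that assms(9,10), of k] p by (simp add: ground)
  qed
  ultimately show ?thesis
    using chernoff_optimum[of _ "n - 1" p k] p n by (simp add: of_nat_diff)
qed

end
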